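(* Let $T$ be an ordinal sum of continuous Archimedean t-norms, $T=(\langle a_\lambda,e_\lambda,T_\lambda\rangle)_{\lambda\in\mathscr A}$. Then: (1) for every $\lambda\in\mathscr A$, $u\in(a_\lambda,e_\lambda)$ and $t>0$, $$u_T^{(t)}=a_\lambda+(e_\lambda-a_\lambda)\left(\frac{u-a_\lambda}{e_\lambda-a_\lambda}\right)_{T_\lambda}^{(t)}=a_\lambda+(e_\lambda-a_\lambda)\,G_\lambda^{(-1)}\left(t\cdot G_\lambda\left(\frac{u-a_\lambda}{e_\lambda-a_\lambda}\right)\right),$$ where $G_\lambda$ is an additive generator of $T_\lambda$ and $G_\lambda^{(-1)}$ is its pseudo-inverse; (2) for every $u\in[0,1]\setminus\bigcup_{\lambda\in\mathscr A}(a_\lambda,e_\lambda)$ and $t>0$, $u_T^{(t)}=u$.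
   Context: A t-norm is a map $T:[0,1]^2\to[0,1]$ that is commutative, associative, nondecreasing in each argument, and satisfies $T(x,1)=x$. It is Archimedean if for all $x,y\in(0,1)$ there is $m\in\mathbb N=\{1,2,\dots\}$ with $x_T^{(m)}<y$. Ordinal sum: for a family of t-norms $\{T_\lambda\}_{\lambda\in\mathscr A}$ and a family of non-empty pairwise disjoint open subintervals $\{(a_\lambda,e_\lambda)\}_{\lambda\in\mathscr A}$ of $[0,1]$, $T=(\langle a_\lambda,e_\lambda,T_\lambda\rangle)_{\lambda\in\mathscr A}$ is defined by $T(x,y)=a_\lambda+(e_\lambda-a_\lambda)T_\lambda\left(\frac{x-a_\lambda}{e_\lambda-a_\lambda},\frac{y-a_\lambda}{e_\lambda-a_\lambda}\right)$ if $(x,y)\in[a_\lambda,e_\lambda]^2$, and $T(x,y)=\min\{x,y\}$ otherwise. An additive generator of a t-norm $T$ is a strictly decreasing map $G:[0,1]\to[0,+\infty]$, right-continuous at $0$, with $G(1)=0$, such that for all $x,y\in[0,1]$: $G(x)+G(y)\in\mathrm{Ran}(G)\cup[G(0),+\infty]$ and $T(x,y)=G^{(-1)}(G(x)+G(y))$. Here the pseudo-inverse of such a $G$ is $G^{(-1)}(y)=\sup\{x\in[0,1]\mid G(x)>y\}$ (with $\sup\varnothing=0$). Every continuous Archimedean t-norm has a continuous additive generator. Powers: for $x\in[0,1]$ put $x_T^{(0)}=1$, $x_T^{(1)}=x$, $x_T^{(n)}=T(x_T^{(n-1)},x)$. For $T$ continuous, $u\in[0,1]$, $p,q\in\mathbb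 N$: $u_T^{(1/p)}=\sup\{v\in[0,1]\mid v_T^{(p)}<u\}$ (with $\sup\varnothing=0$) and $u_T^{(q/p)}=(u_T^{(1/p)})_T^{(q)}$ (independent of the representation of the fraction). For real $t>0$: $u_T^{(t)}=\inf\{u_T^{(r)}\mid r\in[0,t]\cap\mathbb Q\}$, which agrees with the preceding definition for rational $t>0$. *)

theory Defs
  imports "HOL-Analysis.Analysis"
begin

text \<open>Operations on \<open>[0,1]\<close> are modelled by total functions on the reals; every condition and every
  supremum below is restricted to the unit interval, so values elsewhere are irrelevant.\<close>

definition tnorm :: "(real \<Rightarrow> real \<Rightarrow> real) \<Rightarrow> bool" where
  "tnorm T \<longleftrightarrow>
     (\<forall>x\<in>{0..1}. \<forall>y\<in>{0..1}. T x y \<in> {0..1}) \<and>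
     (\<forall>x\<in>{0..1}. \<forall>y\<in>{0..1}. T x y = T y x) \<and>
     (\<forall>x\<in>{0..1}. \<forall>y\<in>{0..1}. \<forall>z\<in>{0..1}. T (T x y) z = T x (T y z)) \<and>
     (\<forall>y\<in>{0..1}. mono_on {0..1} (\<lambda>x. T x y)) \<and>
     (\<forall>x\<in>{0..1}. mono_on {0..1} (\<lambda>y. T x y)) \<and>
     (\<forall>x\<in>{0..1}. T x 1 = x)"

definition continuous_tnorm :: "(real \<Rightarrow> real \<Rightarrow> real) \<Rightarrow> bool" where
  "continuous_tnorm T \<longleftrightarrow> tnorm T \<and> continuous_on ({0..1} \<times> {0..1}) (\<lambda>(x, y). T x y)"

fun nat_power :: "(real \<Rightarrow> real \<Rightarrow> real) \<Rightarrow> real \<Rightarrow> nat \<Rightarrow> real" where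
  "nat_power T x 0 = 1"
| "nat_power T x (Suc 0) = x"
| "nat_power T x (Suc (Suc n)) = T (nat_power T x (Suc n)) x"

definition archimedean_tnorm :: "(real \<Rightarrow> real \<Rightarrow> real) \<Rightarrow> bool" where
  "archimedean_tnorm T \<longleftrightarrow>
     tnorm T \<and> (\<forall>x\<in>{0<..<1}. \<forall>y\<in>{0<..<1}. \<exists>m\<ge>1. nat_power T x m < y)"

text \<open>The library leaves \<open>Sup {}\<close> unspecified on the reals; here it has to be 0.\<close>

definition sup0 :: "real set \<Rightarrow> real" where
  "sup0 X = (if X = {} then 0 else Sup X)"

definition root_power :: "(real \<Rightarrow> real \<Rightarrow> real) \<Rightarrow> real \<Rightarrow> nat \<Rightarrow> real" where
  "root_power T u p = sup0 {v\<in>{0..1}. nat_power T v p < u}"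

text \<open>Meant for \<open>r \<ge> 0\<close>. The reduced fraction of \<open>r\<close> is used; for a continuous t-norm every
  other fraction representing \<open>r\<close> gives the same value.\<close>

definition rat_power :: "(real \<Rightarrow> real \<Rightarrow> real) \<Rightarrow> real \<Rightarrow> rat \<Rightarrow> real" where
  "rat_power T u r = (case quotient_of r of (q, p) \<Rightarrow> nat_power T (root_power T u (nat p)) (nat q))"

definition real_power :: "(real \<Rightarrow> real \<Rightarrow> real) \<Rightarrow> real \<Rightarrow> real \<Rightarrow> real" where
  "real_power T u t = Inf {rat_power T u r | r. 0 \<le> r \<and> of_rat r \<le> t}"

definition pseudo_inverse :: "(real \<Rightarrow> ennreal) \<Rightarrow> ennreal \<Rightarrow> real" where
  "pseudo_inverse G y = sup0 {x\<in>{0..1}. G x > y}"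

definition additive_generator :: "(real \<Rightarrow> real \<Rightarrow> real) \<Rightarrow> (real \<Rightarrow> ennreal) \<Rightarrow> bool" where
  "additive_generator T G \<longleftrightarrow>
     strict_antimono_on {0..1} G \<and> continuous (at_right 0) G \<and> G 1 = 0 \<and>
     (\<forall>x\<in>{0..1}. \<forall>y\<in>{0..1}.
        G x + G y \<in> G ` {0..1} \<union> {G 0..} \<and>
        T x y = pseudo_inverse G (G x + G y))"

text \<open>Two of the squares \<open>[a i, e i]\<^sup>2\<close> can meet only in a common corner \<open>(c, c)\<close> with
  \<open>c = e i = a j\<close>; there both formulas give the value \<open>c\<close> when the summands are t-norms. So the
  conditions are consistent and determine \<open>T\<close> on the unit square.\<close>

definition is_ordinal_sum ::
  "(real \<Rightarrow> real \<Rightarrow> real) \<Rightarrow> 'i set \<Rightarrow> ('i \<Rightarrow> real) \<Rightarrow> ('i \<Rightarrow> real) \<Rightarrow>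
   ('i \<Rightarrow> real \<Rightarrow> real \<Rightarrow> real) \<Rightarrow> bool" where
  "is_ordinal_sum T A a e S \<longleftrightarrow>
     (\<forall>i\<in>A. tnorm (S i)) \<and>
     (\<forall>i\<in>A. 0 \<le> a i \<and> a i < e i \<and> e i \<le> 1) \<and>
     disjoint_family_on (\<lambda>i. {a i<..<e i}) A \<and>
     (\<forall>i\<in>A. \<forall>x\<in>{a i..e i}. \<forall>y\<in>{a i..e i}.
        T x y = a i + (e i - a i) * S i ((x - a i) / (e i - a i)) ((y - a i) / (e i - a i))) \<and>
     (\<forall>x\<in>{0..1}. \<forall>y\<in>{0..1}. (\<forall>i\<in>A. \<not> (x \<in> {a i..e i} \<and> y \<in> {a i..e i})) \<longrightarrow>
        T x y = min x y)"

end

theory Submission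
  imports Defs
begin

text \<open>
  Write \<open>\<phi> x = a i + (e i - a i) * x\<close> for the affine map of \<open>[0,1]\<close> onto the \<open>i\<close>-th summand
  interval; it carries \<open>S i\<close> to the restriction of \<open>T\<close>. The proof rests on three observations.

  A point \<open>u\<close> outside all open summand intervals acts as a barrier for \<open>T\<close>: products of two
  arguments \<open>\<ge> u\<close> stay \<open>\<ge> u\<close>, while products never exceed their left argument (lemmas
  \<open>ordinal_sum_ge_barrier\<close> and \<open>ordinal_sum_le_left\<close>). Hence \<open>v_T^(p) < u\<close> holds exactly when
  \<open>v < u\<close>, all roots and positive powers of \<open>u\<close> are \<open>u\<close> itself, and part (2) follows.

  The right end point of a summand interval is a barrier, and points to the left of \<open>a i\<close> have
  powers to the left of \<open>a i\<close>. So, for \<open>u\<close> inside the interval, the set \<open>{v. v_T^(p) < u}\<close>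
  consists of everything below \<open>a i\<close> and the \<open>\<phi>\<close>-image of the corresponding set for \<open>S i\<close>. Its
  supremum is therefore transported by \<open>\<phi>\<close>, and so are positive rational powers. The power with
  exponent 0 is 1 and in general not \<open>\<phi> 1\<close>, but it does not influence the infimum that defines
  a real power (lemma \<open>real_power_eq_Inf_pos\<close>).

  Within a summand, an additive generator \<open>G\<close> turns powers into truncated multiples:
  \<open>G (v^(n)) = min (n * G v) (G 0)\<close>. As \<open>v \<mapsto> v^(p)\<close> is continuous, the intermediate value
  theorem yields an exact \<open>p\<close>-th root \<open>v\<close> of \<open>u\<close>, and then \<open>p * G v = G u\<close>. So \<open>G u / p\<close> is
  attained by \<open>G\<close>, and the formula \<open>u^(r) = G^(-1) (r * G u)\<close> follows for positive rational \<open>r\<close>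
  (lemma \<open>rat_power_generator\<close>). The passage to real exponents rests on \<open>G\<close> being strictly
  decreasing: if the infimum of the rational powers were larger than \<open>G^(-1) (t * G u)\<close>, then
  \<open>G\<close> would be constant with value \<open>t * G u\<close> between the two.
\<close>

section \<open>Suprema and powers\<close>

lemma sup0_less:
  assumes "z \<in> {0..1}" and "\<And>x. x \<in> {0..1} \<Longrightarrow> P x \<longleftrightarrow> x < z"
  shows "sup0 {x\<in>{0..1}. P x} = z"
proof -
  have eq: "{x\<in>{0..1}. P x} = {0..<z}"
    using assms by auto
  show ?thesis
  proof (cases "z = 0")
    case True
    then show ?thesis unfolding eq by (simp add: sup0_def)
  next
    case False
    then have "0 < z" using assms(1) by simp
    then show ?thesis unfolding eq by (simp add: sup0_def)
  qed
qed

lemma sup0_unit_interval: "sup0 {x\<in>{0..1}. P x} \<in> {0..1}"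
proof (cases "{x\<in>{0..1}. P x} = {}")
  case True
  then show ?thesis by (simp add: sup0_def)
next
  case False
  then obtain x where x: "x \<in> {0..1}" "P x" by auto
  have bdd: "bdd_above {x\<in>{0..1::real}. P x}"
    by (rule bdd_aboveI[of _ 1]) auto
  have "x \<le> Sup {x\<in>{0..1}. P x}"
    using x bdd by (intro cSup_upper) auto
  moreover have "Sup {x\<in>{0..1}. P x} \<le> 1"
    using False by (intro cSup_least) auto
  ultimately show ?thesis
    using False x by (auto simp: sup0_def)
qed

lemma root_power_unit_interval: "root_power T u p \<in> {0..1}"
  unfolding root_power_def by (rule sup0_unit_interval)

lemma nat_power_Suc: "n \<ge> 1 \<Longrightarrow> nat_power T x (Suc n) = T (nat_power T x n) x"
  by (cases n) auto

lemma rat_power_0: "rat_power T u 0 = 1"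
  by (simp add: rat_power_def)

lemma rat_power_fraction:
  assumes "0 < r"
  obtains p q :: nat where "p \<ge> 1" "q \<ge> 1" "real_of_rat r = real q / real p"
    "\<forall>T u. rat_power T u r = nat_power T (root_power T u p) q"
proof -
  obtain q p where qp: "quotient_of r = (q, p)" by fastforce
  have p: "p > 0" using quotient_of_denom_pos[OF qp] .
  have r: "r = of_int q / of_int p" using quotient_of_div[OF qp] .
  have q: "q > 0" using assms p by (simp add: r zero_less_divide_iff)
  show ?thesis
  proof (rule that[of "nat p" "nat q"])
    show "real_of_rat r = real (nat q) / real (nat p)"
      using p q by (simp add: r of_rat_divide)
  qed (use p q qp in \<open>auto simp: rat_power_def\<close>)
qed

lemma exists_pos_rat_le:
  fixes t :: real
  assumes "t > 0"
  obtains r where "0 < r" "of_rat r \<le> t"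
  using of_rat_dense[OF assms] by (metis less_eq_real_def zero_less_of_rat_iff)

text \<open>The exponent 0 contributes the value 1, which is an upper bound of all other powers and so
  can be dropped from the infimum as soon as a positive rational exponent is available.\<close>

lemma real_power_eq_Inf_pos:
  assumes t: "t > 0" and bounds: "\<And>r. 0 < r \<Longrightarrow> rat_power T u r \<in> {0..1}"
  shows "real_power T u t = (INF r\<in>{r. 0 < r \<and> of_rat r \<le> t}. rat_power T u r)"
proof -
  let ?X = "rat_power T u ` {r. 0 < r \<and> of_rat r \<le> t}"
  have eq: "{rat_power T u r | r. 0 \<le> r \<and> of_rat r \<le> t} = insert 1 ?X"
  proof (intro equalityI subsetI)
    fix x assume "x \<in> {rat_power T u r | r. 0 \<le> r \<and> of_rat r \<le> t}"
    then obtain r where "x = rat_power T u r" "0 \<le> r" "of_rat r \<le> t" by blast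
    then show "x \<in> insert 1 ?X"
      by (cases "r = 0") (auto simp: rat_power_0)
  next
    fix x assume "x \<in> insert 1 ?X"
    then show "x \<in> {rat_power T u r | r. 0 \<le> r \<and> of_rat r \<le> t}"
    proof
      assume "x = 1"
      then show ?thesis using t rat_power_0[of T u] by (auto intro!: exI[of _ 0])
    qed auto
  qed
  obtain r where r: "0 < r" "of_rat r \<le> t" using exists_pos_rat_le[OF t] .
  have bdd: "bdd_below ?X"
    by (rule bdd_belowI[of _ 0]) (use bounds in auto)
  have "Inf ?X \<le> 1"
    by (rule cInf_lower2[OF _ _ bdd, of "rat_power T u r"]) (use r bounds in auto)
  moreover have "Inf (insert 1 ?X) = inf 1 (Inf ?X)"
    by (rule cInf_insert) (use r bdd in auto)
  ultimately show ?thesis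
    by (simp add: real_power_def eq inf_real_def)
qed

section \<open>Triangular norms\<close>

lemma tnorm_mem: "tnorm T \<Longrightarrow> x \<in> {0..1} \<Longrightarrow> y \<in> {0..1} \<Longrightarrow> T x y \<in> {0..1}"
  unfolding tnorm_def by blast

lemma tnorm_one: "tnorm T \<Longrightarrow> x \<in> {0..1} \<Longrightarrow> T x 1 = x"
  unfolding tnorm_def by blast

lemma tnorm_le_left:
  assumes "tnorm T" "x \<in> {0..1}" "y \<in> {0..1}"
  shows "T x y \<le> x"
proof -
  have "mono_on {0..1} (T x)"
    using assms(1,2) unfolding tnorm_def by blast
  then have "T x y \<le> T x 1"
    using assms(3) by (intro mono_onD[of "{0..1}" "T x"]) auto
  then show ?thesis using tnorm_one[OF assms(1,2)] by simp
qed

lemma tnorm_zero: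
  assumes "tnorm T" "y \<in> {0..1}"
  shows "T 0 y = 0"
  using tnorm_le_left[OF assms(1) _ assms(2), of 0] tnorm_mem[OF assms(1) _ assms(2), of 0] by simp

lemma tnorm_nat_power_mem: "tnorm T \<Longrightarrow> x \<in> {0..1} \<Longrightarrow> nat_power T x n \<in> {0..1}"
proof (induction n)
  case (Suc n)
  then show ?case using tnorm_mem[of T "nat_power T x n" x] by (cases n) auto
qed simp

lemma tnorm_nat_power_zero:
  assumes "tnorm T" "n \<ge> 1"
  shows "nat_power T 0 n = 0"
  using assms(2)
proof (induction n rule: nat_induct_at_least)
  case (Suc n)
  then show ?case using tnorm_zero[OF assms(1), of 0] by (simp add: nat_power_Suc)
qed simp

lemma tnorm_nat_power_one: "tnorm T \<Longrightarrow> nat_power T 1 n = 1"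
proof (induction n)
  case (Suc n)
  then show ?case using tnorm_one[of T 1] by (cases n) auto
qed simp

lemma continuous_on_nat_power:
  assumes T: "continuous_tnorm T"
  shows "continuous_on {0..1} (\<lambda>x. nat_power T x n)"
proof (induction n)
  case (Suc n)
  have tn: "tnorm T" and ct: "continuous_on ({0..1} \<times> {0..1}) (\<lambda>(x, y). T x y)"
    using T by (auto simp: continuous_tnorm_def)
  show ?case
  proof (cases "n = 0")
    case False
    have "continuous_on {0..1} ((\<lambda>(x, y). T x y) \<circ> (\<lambda>x. (nat_power T x n, x)))"
    proof (rule continuous_on_compose)
      show "continuous_on {0..1} (\<lambda>x. (nat_power T x n, x))"
        using Suc by (intro continuous_on_Pair continuous_on_id)
      show "continuous_on ((\<lambda>x. (nat_power T x n, x)) ` {0..1}) (\<lambda>(x, y). T x y)"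
        by (rule continuous_on_subset[OF ct]) (use tnorm_nat_power_mem[OF tn] in blast)
    qed
    then show ?thesis using False by (simp add: nat_power_Suc o_def)
  qed (simp add: continuous_on_id)
qed simp

lemma exact_root_exists:
  assumes T: "continuous_tnorm T" and u: "u \<in> {0..1}" and p: "p \<ge> 1"
  obtains v where "v \<in> {0..1}" "nat_power T v p = u"
proof -
  have tn: "tnorm T" using T by (simp add: continuous_tnorm_def)
  have "\<exists>v. 0 \<le> v \<and> v \<le> 1 \<and> nat_power T v p = u"
    by (rule IVT') (use u tnorm_nat_power_zero[OF tn p] tnorm_nat_power_one[OF tn]
        continuous_on_nat_power[OF T] in auto)
  then show ?thesis using that by auto
qed

lemma tnorm_rat_power_mem:
  assumes "tnorm T" "0 < r"
  shows "rat_power T u r \<in> {0..1}"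
  using rat_power_fraction[OF assms(2)] tnorm_nat_power_mem[OF assms(1) root_power_unit_interval]
  by metis

section \<open>Powers in terms of an additive generator\<close>

context
  fixes T :: "real \<Rightarrow> real \<Rightarrow> real" and G :: "real \<Rightarrow> ennreal"
  assumes T: "tnorm T" and G: "additive_generator T G"
begin

lemma generator_less_iff:
  assumes "x \<in> {0..1}" "y \<in> {0..1}"
  shows "G x < G y \<longleftrightarrow> y < x"
proof -
  have anti: "G y < G x" if "x < y" "x \<in> {0..1}" "y \<in> {0..1}" for x y
    using G that unfolding additive_generator_def monotone_on_def by blast
  show ?thesis
    using anti[of x y] anti[of y x] assms by (cases x y rule: linorder_cases) auto
qed

lemma generator_le_iff:
  assumes "x \<in> {0..1}" "y \<in> {0..1}"
  shows "G x \<le> G y \<longleftrightarrow> y \<le> x"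
  using generator_less_iff[OF assms(2,1)] by (simp add: not_less[symmetric])

text \<open>Values beyond \<open>G 0\<close> are all sent to 0, so the pseudo-inverse inverts \<open>G\<close> up to truncation
  at \<open>G 0\<close>.\<close>

lemma pseudo_inverse_eqI:
  assumes z: "z \<in> {0..1}" and Gz: "G z = min y (G 0)"
  shows "pseudo_inverse G y = z"
  unfolding pseudo_inverse_def
proof (rule sup0_less[OF z])
  fix x :: real assume x: "x \<in> {0..1}"
  have "G x \<le> G 0" using x generator_le_iff[of x 0] by simp
  then have "y < G x \<longleftrightarrow> G z < G x" by (auto simp: Gz min_def)
  then show "y < G x \<longleftrightarrow> x < z" using generator_less_iff[OF z x] by simp
qed

text \<open>By the range condition on \<open>G\<close>, the sum \<open>G x + G y\<close> is either a value of \<open>G\<close>, which the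
  pseudo-inverse inverts exactly, or beyond the truncation level.\<close>

lemma generator_tnorm:
  assumes x: "x \<in> {0..1}" and y: "y \<in> {0..1}"
  shows "G (T x y) = min (G x + G y) (G 0)"
proof -
  have T_eq: "T x y = pseudo_inverse G (G x + G y)"
    and ran: "G x + G y \<in> G ` {0..1} \<union> {G 0..}"
    using G x y unfolding additive_generator_def by blast+
  obtain z where z: "z \<in> {0..1}" "G z = min (G x + G y) (G 0)"
  proof (cases "G 0 \<le> G x + G y")
    case True
    then show ?thesis using that[of 0] by (simp add: min_def)
  next
    case False
    then obtain z where "z \<in> {0..1}" "G x + G y = G z" using ran by auto
    moreover have "min (G x + G y) (G 0) = G x + G y" using False by simp
    ultimately show ?thesis using that[of z] by simp
  qed
  then show ?thesis using T_eq pseudo_inverse_eqI[OF z] by simp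
qed

lemma generator_nat_power:
  assumes x: "x \<in> {0..1}"
  shows "G (nat_power T x n) = min (of_nat n * G x) (G 0)"
proof (induction n)
  case 0
  then show ?case using G by (simp add: additive_generator_def min_def)
next
  case (Suc n)
  show ?case
  proof (cases "n = 0")
    case True
    then show ?thesis using generator_le_iff[of x 0] x by (simp add: min_def)
  next
    case False
    have "G (nat_power T x (Suc n)) = min (min (of_nat n * G x) (G 0) + G x) (G 0)"
      using False generator_tnorm[OF tnorm_nat_power_mem[OF T x] x] Suc
      by (simp add: nat_power_Suc)
    also have "\<dots> = min (of_nat n * G x + G x) (G 0)"
    proof (cases "of_nat n * G x \<le> G 0")
      case False
      then have "G 0 \<le> of_nat n * G x" by simp
      then have "G 0 \<le> of_nat n * G x + G x" by (rule add_increasing2[rotated]) simp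
      with False show ?thesis by (simp add: min_def)
    qed (simp add: min_def)
    finally show ?thesis by (simp add: distrib_right add.commute)
  qed
qed

lemma generator_finite_pos:
  assumes "u \<in> {0<..<1}"
  obtains g where "0 < g" "G u = ennreal g"
proof -
  have "G u < G 0" "G 1 < G u"
    using generator_less_iff[of u 0] generator_less_iff[of 1 u] assms by auto
  then have "0 < G u" "G u < top"
    by (auto intro: le_less_trans less_le_trans)
  then show ?thesis using that by (auto simp: less_top_ennreal)
qed

text \<open>An exact \<open>p\<close>-th root, when it exists, is the one that the supremum selects: \<open>u > 0\<close>
  means that \<open>p * G v = G u\<close> is still below the truncation level \<open>G 0\<close>, so every \<open>w < v\<close> has a
  strictly smaller \<open>p\<close>-th power.\<close>

lemma root_power_eqI:
  assumes u: "u \<in> {0<..<1}" and v: "v \<in> {0..1}" and p: "p \<ge> 1" and root: "nat_power T v p = u"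
  shows "of_nat p * G v = G u" and "root_power T u p = v"
proof -
  have u01: "u \<in> {0..1}" using u by simp
  have lt0: "G u < G 0" using generator_less_iff[of u 0] u by simp
  have "min (of_nat p * G v) (G 0) = G u"
    using generator_nat_power[OF v, of p] root by simp
  then show pv: "of_nat p * G v = G u"
    using lt0 by (auto simp: min_def split: if_splits)
  show "root_power T u p = v"
    unfolding root_power_def
  proof (rule sup0_less[OF v])
    fix w :: real assume w: "w \<in> {0..1}"
    have "nat_power T w p < u \<longleftrightarrow> G u < min (of_nat p * G w) (G 0)"
      using generator_less_iff[OF u01 tnorm_nat_power_mem[OF T w]] generator_nat_power[OF w] by simp
    also have "\<dots> \<longleftrightarrow> of_nat p * G v < of_nat p * G w"
      using lt0 pv by simp
    also have "\<dots> \<longleftrightarrow> G v < G w"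
    proof
      assume "of_nat p * G v < of_nat p * G w"
      then show "G v < G w" by (metis mult_left_mono not_le zero_le)
    next
      assume "G v < G w"
      then show "of_nat p * G v < of_nat p * G w"
        using p by (intro ennreal_mult_strict_left_mono) (auto simp: of_nat_less_top)
    qed
    finally show "nat_power T w p < u \<longleftrightarrow> w < v"
      using generator_less_iff[OF v w] by simp
  qed
qed

text \<open>With \<open>v\<close> an exact \<open>p\<close>-th root, \<open>q * G v = (q / p) * G u\<close>, and \<open>v^(q)\<close> is the point whose
  \<open>G\<close>-value is the truncation of this number.\<close>

lemma rat_power_generator:
  assumes cont: "continuous_tnorm T" and u: "u \<in> {0<..<1}" and r: "0 < r"
  shows "rat_power T u r = pseudo_inverse G (ennreal (of_rat r) * G u)"
proof -
  obtain p q where pq: "p \<ge> 1" "q \<ge> 1" "real_of_rat r = real q / real p"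
    "\<forall>T u. rat_power T u r = nat_power T (root_power T u p) q"
    using rat_power_fraction[OF r] .
  have u01: "u \<in> {0..1}" using u by simp
  obtain v where v: "v \<in> {0..1}" "nat_power T v p = u"
    using exact_root_exists[OF cont u01 pq(1)] .
  note root = root_power_eqI[OF u v(1) pq(1) v(2)]
  have "ennreal (of_rat r) * (of_nat p * G v) = ennreal (real q / real p * real p) * G v"
    unfolding pq(3) by (subst ennreal_mult) (auto simp: ennreal_of_nat_eq_real_of_nat mult.assoc)
  also have "\<dots> = of_nat q * G v"
    using pq(1) by (simp add: ennreal_of_nat_eq_real_of_nat)
  finally have "G (nat_power T v q) = min (ennreal (of_rat r) * G u) (G 0)"
    using generator_nat_power[OF v(1), of q] root(1) by simp
  then show ?thesis
    using pseudo_inverse_eqI[OF tnorm_nat_power_mem[OF T v(1)]] root(2) pq(4) by simp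
qed

lemma generator_gt_of_less_pseudo_inverse:
  assumes "x \<in> {0..1}" "x < pseudo_inverse G y"
  shows "y < G x"
proof -
  let ?X = "{x\<in>{0..1}. y < G x}"
  have "?X \<noteq> {}" using assms by (auto simp: pseudo_inverse_def sup0_def split: if_splits)
  then have "x < Sup ?X" using assms by (simp add: pseudo_inverse_def sup0_def split: if_splits)
  then obtain w where w: "w \<in> ?X" "x < w"
    using less_cSupD[OF \<open>?X \<noteq> {}\<close>] by blast
  then show ?thesis using generator_less_iff[of w x] assms(1) by force
qed

lemma generator_le_of_pseudo_inverse_less:
  assumes x: "x \<in> {0..1}" and less: "pseudo_inverse G y < x"
  shows "G x \<le> y"
proof (rule ccontr)
  assume "\<not> G x \<le> y"
  then have mem: "x \<in> {x\<in>{0..1}. y < G x}" using x by simp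
  have "bdd_above {x\<in>{0..1::real}. y < G x}" by (rule bdd_aboveI[of _ 1]) auto
  then have "x \<le> pseudo_inverse G y"
    using mem cSup_upper[OF mem] by (auto simp: pseudo_inverse_def sup0_def)
  then show False using less by simp
qed

text \<open>Monotonicity of the pseudo-inverse gives one inequality. It could only be strict if \<open>G\<close> were
  constant on an interval, since the rationals below \<open>t\<close> approach \<open>t\<close>.\<close>

lemma real_power_generator:
  assumes cont: "continuous_tnorm T" and u: "u \<in> {0<..<1}" and t: "t > 0"
  shows "real_power T u t = pseudo_inverse G (ennreal t * G u)"
proof -
  let ?R = "{r. 0 < r \<and> of_rat r \<le> t}"
  define s where "s = pseudo_inverse G (ennreal t * G u)"
  define c where "c = (INF r\<in>?R. rat_power T u r)"
  obtain g where g: "0 < g" "G u = ennreal g" using generator_finite_pos[OF u] .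
  obtain r0 where r0: "r0 \<in> ?R" using exists_pos_rat_le[OF t] by blast
  have s01: "s \<in> {0..1}" unfolding s_def pseudo_inverse_def by (rule sup0_unit_interval)
  have mem: "rat_power T u r \<in> {0..1}" if "0 < r" for r
    using tnorm_rat_power_mem[OF T that] .
  have bdd: "bdd_below (rat_power T u ` ?R)"
    by (rule bdd_belowI[of _ 0]) (use mem in auto)
  have c1: "c \<le> 1"
    unfolding c_def using r0 mem by (intro cINF_lower2[OF bdd r0]) auto
  have "s \<le> c"
    unfolding c_def
  proof (rule cINF_greatest)
    show "?R \<noteq> {}" using r0 by blast
    fix r assume r: "r \<in> ?R"
    show "s \<le> rat_power T u r"
    proof (rule ccontr)
      assume "\<not> s \<le> rat_power T u r"
      then obtain x where x: "rat_power T u r < x" "x < s" using dense by (meson not_le)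
      then have x01: "x \<in> {0..1}" using s01 mem[of r] r by auto
      have "ennreal t * G u < G x"
        using generator_gt_of_less_pseudo_inverse[OF x01] x(2) by (simp add: s_def)
      also have "G x \<le> ennreal (of_rat r) * G u"
        using generator_le_of_pseudo_inverse_less[OF x01] x(1) rat_power_generator[OF cont u] r
        by simp
      also have "\<dots> \<le> ennreal t * G u"
        using r by (intro mult_right_mono ennreal_leI) auto
      finally show False by simp
    qed
  qed
  moreover have "\<not> s < c"
  proof
    assume "s < c"
    have const: "G x = ennreal t * G u" if x: "s < x" "x < c" for x
    proof (rule antisym)
      have x01: "x \<in> {0..1}" using x s01 c1 by auto
      show "G x \<le> ennreal t * G u"
        using generator_le_of_pseudo_inverse_less[OF x01] x(1) by (simp add: s_def)
      also have "\<dots> < top" using g by (simp add: ennreal_mult_less_top)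
      finally have "G x < top" .
      then obtain h where h: "0 \<le> h" "G x = ennreal h" by (cases "G x") auto
      have "t \<le> h / g"
      proof (rule ccontr)
        assume "\<not> t \<le> h / g"
        then obtain r where r: "h / g < of_rat r" "of_rat r < t" using of_rat_dense by (meson not_le)
        then have pos: "0 < r" using h(1) g(1)
          by (metis divide_nonneg_pos le_less_trans zero_less_of_rat_iff)
        have "c \<le> rat_power T u r"
          unfolding c_def using pos r by (intro cINF_lower[OF bdd]) auto
        then have "ennreal (of_rat r) * G u < G x"
          using generator_gt_of_less_pseudo_inverse[OF x01] x(2) rat_power_generator[OF cont u pos]
          by simp
        then have "of_rat r * g < h"
          using pos g h by (simp add: ennreal_mult[symmetric] ennreal_less_iff)
        then show False using r(1) g(1) by (simp add: field_simps)
      qed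
      then have "t * g \<le> h" using g(1) by (simp add: field_simps)
      then show "ennreal t * G u \<le> G x"
        using t g h by (simp add: ennreal_mult[symmetric])
    qed
    obtain x where x: "s < x" "x < c" using dense[OF \<open>s < c\<close>] by blast
    obtain y where y: "x < y" "y < c" using dense[OF x(2)] by blast
    have "G x = G y" using const x y by simp
    then show False
      using generator_less_iff[of y x] x y s01 c1 by auto
  qed
  ultimately have "c = s" by simp
  then show ?thesis
    using real_power_eq_Inf_pos[OF t mem] by (simp add: c_def s_def)
qed

end

section \<open>Ordinal sums\<close>

context
  fixes A :: "'i set" and a e :: "'i \<Rightarrow> real"
    and S :: "'i \<Rightarrow> real \<Rightarrow> real \<Rightarrow> real" and T :: "real \<Rightarrow> real \<Rightarrow> real"
  assumes sum: "is_ordinal_sum T A a e S"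
begin

lemma summand_tnorm: "i \<in> A \<Longrightarrow> tnorm (S i)"
  and summand_bounds: "i \<in> A \<Longrightarrow> 0 \<le> a i \<and> a i < e i \<and> e i \<le> 1"
  using sum unfolding is_ordinal_sum_def by blast+

lemma summand_embedding:
  assumes i: "i \<in> A" and "x \<in> {0..1}" "y \<in> {0..1}"
  shows "T (a i + (e i - a i) * x) (a i + (e i - a i) * y) = a i + (e i - a i) * S i x y"
proof -
  let ?f = "\<lambda>x. a i + (e i - a i) * x"
  have len: "e i - a i > 0" using summand_bounds[OF i] by simp
  have mem: "?f z \<in> {a i..e i}" if "z \<in> {0..1}" for z
  proof -
    have "?f z \<le> ?f 1" using that len by (intro add_left_mono mult_left_mono) auto
    also have "?f 1 = e i" by simp
    finally have "?f z \<le> e i" .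
    moreover have "a i \<le> ?f z" using that len by simp
    ultimately show ?thesis by simp
  qed
  have "T (?f x) (?f y) = ?f (S i ((?f x - a i) / (e i - a i)) ((?f y - a i) / (e i - a i)))"
    using sum i mem assms(2,3) unfolding is_ordinal_sum_def by blast
  then show ?thesis using len by simp
qed

lemma outside_summands:
  "x \<in> {0..1} \<Longrightarrow> y \<in> {0..1} \<Longrightarrow> (\<And>i. i \<in> A \<Longrightarrow> \<not> (x \<in> {a i..e i} \<and> y \<in> {a i..e i})) \<Longrightarrow>
    T x y = min x y"
  using sum unfolding is_ordinal_sum_def by blast

lemma in_summand:
  assumes i: "i \<in> A" and x: "x \<in> {a i..e i}"
  obtains x' where "x' \<in> {0..1}" "x = a i + (e i - a i) * x'"
proof (rule that[of "(x - a i) / (e i - a i)"])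
  have len: "e i - a i > 0" using summand_bounds[OF i] by simp
  then show "(x - a i) / (e i - a i) \<in> {0..1}" using x by simp
  show "x = a i + (e i - a i) * ((x - a i) / (e i - a i))" using len by simp
qed

lemma ordinal_sum_le_left:
  assumes x: "x \<in> {0..1}" and y: "y \<in> {0..1}"
  shows "T x y \<le> x"
proof (cases "\<exists>i\<in>A. x \<in> {a i..e i} \<and> y \<in> {a i..e i}")
  case True
  then obtain i where i: "i \<in> A" "x \<in> {a i..e i}" "y \<in> {a i..e i}" by blast
  obtain x' where x': "x' \<in> {0..1}" "x = a i + (e i - a i) * x'" using in_summand[OF i(1,2)] .
  obtain y' where y': "y' \<in> {0..1}" "y = a i + (e i - a i) * y'" using in_summand[OF i(1,3)] .
  show ?thesis
    using tnorm_le_left[OF summand_tnorm[OF i(1)] x'(1) y'(1)] summand_bounds[OF i(1)]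
    unfolding x'(2) y'(2) summand_embedding[OF i(1) x'(1) y'(1)] by (simp add: mult_left_mono)
next
  case False
  then show ?thesis using outside_summands[OF x y] by auto
qed

text \<open>A product of points in one summand square stays in the summand interval, and a point
  outside the open interval lies below all of it or is at or above its right end point. In the
  latter case both factors equal that end point, which is idempotent.\<close>

lemma ordinal_sum_ge_barrier:
  assumes u: "u \<in> {0..1} - (\<Union>i\<in>A. {a i<..<e i})"
    and x: "x \<in> {u..1}" and y: "y \<in> {u..1}"
  shows "u \<le> T x y"
proof (cases "\<exists>i\<in>A. x \<in> {a i..e i} \<and> y \<in> {a i..e i}")
  case True
  then obtain i where i: "i \<in> A" "x \<in> {a i..e i}" "y \<in> {a i..e i}" by blast
  note S = summand_tnorm[OF i(1)]
  have len: "e i - a i > 0" using summand_bounds[OF i(1)] by simp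
  from u i(1) consider "u \<le> a i" | "e i \<le> u" by force
  then show ?thesis
  proof cases
    case 1
    obtain x' where x': "x' \<in> {0..1}" "x = a i + (e i - a i) * x'" using in_summand[OF i(1,2)] .
    obtain y' where y': "y' \<in> {0..1}" "y = a i + (e i - a i) * y'" using in_summand[OF i(1,3)] .
    have "0 \<le> (e i - a i) * S i x' y'" using len tnorm_mem[OF S x'(1) y'(1)] by simp
    then show ?thesis
      using 1 unfolding x'(2) y'(2) summand_embedding[OF i(1) x'(1) y'(1)] by simp
  next
    case 2
    then have "x = e i" "y = e i" "u = e i" using i x y by auto
    then show ?thesis
      using summand_embedding[OF i(1), of 1 1] tnorm_one[OF S, of 1] by simp
  qed
next
  case False
  then show ?thesis using outside_summands[of x y] u x y by auto
qed

lemma ordinal_sum_mem: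
  assumes "x \<in> {0..1}" "y \<in> {0..1}"
  shows "T x y \<in> {0..1}"
proof -
  have "0 \<in> {0..1} - (\<Union>i\<in>A. {a i<..<e i})" using summand_bounds by force
  then show ?thesis using ordinal_sum_ge_barrier[of 0 x y] ordinal_sum_le_left[of x y] assms by auto
qed

lemma ordinal_sum_nat_power_mem:
  assumes x: "x \<in> {0..1}" and n: "n \<ge> 1"
  shows "nat_power T x n \<in> {0..x}"
  using n
proof (induction n rule: nat_induct_at_least)
  case base
  then show ?case using x by simp
next
  case (Suc n)
  then have "nat_power T x n \<in> {0..1}" using x by auto
  then show ?case
    using Suc x ordinal_sum_le_left[of "nat_power T x n" x] ordinal_sum_mem[of "nat_power T x n" x]
    by (auto simp: nat_power_Suc)
qed

lemma nat_power_ge_barrier: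
  assumes u: "u \<in> {0..1} - (\<Union>i\<in>A. {a i<..<e i})" and x: "x \<in> {u..1}" and n: "n \<ge> 1"
  shows "u \<le> nat_power T x n"
  using n
proof (induction n rule: nat_induct_at_least)
  case base
  then show ?case using x by simp
next
  case (Suc n)
  have "nat_power T x n \<le> 1" using ordinal_sum_nat_power_mem[of x n] Suc x u by auto
  then show ?case
    using Suc x ordinal_sum_ge_barrier[OF u, of "nat_power T x n" x] by (simp add: nat_power_Suc)
qed

lemma rat_power_barrier:
  assumes u: "u \<in> {0..1} - (\<Union>i\<in>A. {a i<..<e i})" and r: "0 < r"
  shows "rat_power T u r = u"
proof -
  obtain p q where pq: "p \<ge> 1" "q \<ge> 1" "real_of_rat r = real q / real p"
    "\<forall>T u. rat_power T u r = nat_power T (root_power T u p) q"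
    using rat_power_fraction[OF r] .
  have "root_power T u p = u"
    unfolding root_power_def
  proof (rule sup0_less)
    fix v :: real assume v: "v \<in> {0..1}"
    show "nat_power T v p < u \<longleftrightarrow> v < u"
      using ordinal_sum_nat_power_mem[OF v pq(1)] nat_power_ge_barrier[OF u _ pq(1), of v] v
      by (cases "v < u") auto
  qed (use u in simp)
  moreover have "nat_power T u q = u"
    using ordinal_sum_nat_power_mem[OF _ pq(2), of u] nat_power_ge_barrier[OF u _ pq(2), of u] u
    by fastforce
  ultimately show ?thesis using pq(4) by simp
qed

lemma real_power_barrier:
  assumes u: "u \<in> {0..1} - (\<Union>i\<in>A. {a i<..<e i})" and t: "t > 0"
  shows "real_power T u t = u"
proof -
  obtain r where "0 < r" "of_rat r \<le> t" using exists_pos_rat_le[OF t] .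
  then have "{r. 0 < r \<and> of_rat r \<le> t} \<noteq> {}" by blast
  then show ?thesis
    using real_power_eq_Inf_pos[OF t, of T u] rat_power_barrier[OF u] u by simp
qed

lemma right_end_barrier:
  assumes i: "i \<in> A"
  shows "e i \<in> {0..1} - (\<Union>j\<in>A. {a j<..<e j})"
proof -
  have False if j: "j \<in> A" "a j < e i" "e i < e j" for j
  proof -
    \<comment> \<open>Such an interval would overlap the \<open>i\<close>-th one immediately to the left of \<open>e i\<close>.\<close>
    obtain z where "max (a i) (a j) < z" "z < e i"
      using dense[of "max (a i) (a j)" "e i"] j summand_bounds[OF i] by auto
    then have "z \<in> {a i<..<e i} \<inter> {a j<..<e j}" using j by auto
    moreover have "i \<noteq> j" using j by auto
    then have "{a i<..<e i} \<inter> {a j<..<e j} = {}"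
      using sum i j(1) unfolding is_ordinal_sum_def disjoint_family_on_def by blast
    ultimately show False by blast
  qed
  then show ?thesis using summand_bounds[OF i] by fastforce
qed

lemma nat_power_summand:
  assumes i: "i \<in> A" and x: "x \<in> {0..1}" and n: "n \<ge> 1"
  shows "nat_power T (a i + (e i - a i) * x) n = a i + (e i - a i) * nat_power (S i) x n"
  using n
proof (induction n rule: nat_induct_at_least)
  case (Suc n)
  then show ?case
    using summand_embedding[OF i tnorm_nat_power_mem[OF summand_tnorm[OF i] x] x]
    by (simp add: nat_power_Suc)
qed simp

text \<open>Points above \<open>e i\<close> have powers at least \<open>e i\<close> since \<open>e i\<close> is a barrier, and points below
  \<open>a i\<close> have small powers but do not influence the supremum, because the summand itself
  already contributes \<open>a i\<close>.\<close>

lemma root_power_summand: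
  assumes i: "i \<in> A" and u: "u \<in> {0<..<1}" and p: "p \<ge> 1"
  shows "root_power T (a i + (e i - a i) * u) p = a i + (e i - a i) * root_power (S i) u p"
proof -
  let ?f = "\<lambda>x. a i + (e i - a i) * x"
  let ?X = "{v\<in>{0..1}. nat_power T v p < ?f u}"
  let ?Y = "{v\<in>{0..1}. nat_power (S i) v p < u}"
  have len: "e i - a i > 0" and ai: "0 \<le> a i" and ei: "e i \<le> 1"
    using summand_bounds[OF i] by auto
  have f_less: "?f x < ?f y \<longleftrightarrow> x < y" and f_le: "?f x \<le> ?f y \<longleftrightarrow> x \<le> y" for x y
    using len by simp_all
  have f_mem: "?f x \<in> {a i..e i}" if "x \<in> {0..1}" for x
    using f_le[of 0 x] f_le[of x 1] that by simp
  have inX: "?f v \<in> ?X" if "v \<in> ?Y" for v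
    using that f_mem[of v] ai ei f_less nat_power_summand[OF i _ p, of v] by auto
  have zero: "0 \<in> ?Y" using tnorm_nat_power_zero[OF summand_tnorm[OF i] p] u by simp
  have bddY: "bdd_above ?Y" by (rule bdd_aboveI[of _ 1]) auto
  have "Sup ?X = ?f (Sup ?Y)"
  proof (rule cSup_eq_non_empty)
    show "?X \<noteq> {}" using inX[OF zero] by blast
  next
    fix v assume v: "v \<in> ?X"
    have "v < e i"
    proof (rule ccontr)
      assume "\<not> v < e i"
      then have "e i \<le> nat_power T v p"
        using nat_power_ge_barrier[OF right_end_barrier[OF i] _ p, of v] v by simp
      then show False using v f_less[of u 1] u by simp
    qed
    consider "v < a i" | "v \<in> {a i..e i}" using \<open>v < e i\<close> by fastforce
    then show "v \<le> ?f (Sup ?Y)"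
    proof cases
      case 1
      then show ?thesis using f_le[of 0 "Sup ?Y"] cSup_upper[OF zero bddY] by simp
    next
      case 2
      obtain w where w: "w \<in> {0..1}" "v = ?f w" using in_summand[OF i 2] .
      have "w \<in> ?Y" using v w nat_power_summand[OF i w(1) p] f_less by simp
      then show ?thesis using cSup_upper[OF _ bddY] f_le unfolding w(2) by blast
    qed
  next
    fix b assume b: "\<And>v. v \<in> ?X \<Longrightarrow> v \<le> b"
    have "w \<le> (b - a i) / (e i - a i)" if "w \<in> ?Y" for w
      using b[OF inX[OF that]] len by (simp add: field_simps)
    then have "Sup ?Y \<le> (b - a i) / (e i - a i)" using zero by (intro cSup_least) blast+
    then show "?f (Sup ?Y) \<le> b" using len by (simp add: field_simps)
  qed
  moreover have "?X \<noteq> {}" "?Y \<noteq> {}" using inX[OF zero] zero by blast+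
  ultimately show ?thesis unfolding root_power_def sup0_def by (simp only: if_False)
qed

lemma rat_power_summand:
  assumes i: "i \<in> A" and u: "u \<in> {0<..<1}" and r: "0 < r"
  shows "rat_power T (a i + (e i - a i) * u) r = a i + (e i - a i) * rat_power (S i) u r"
proof -
  obtain p q where pq: "p \<ge> 1" "q \<ge> 1" "real_of_rat r = real q / real p"
    "\<forall>T u. rat_power T u r = nat_power T (root_power T u p) q"
    using rat_power_fraction[OF r] .
  show ?thesis
    using root_power_summand[OF i u pq(1)]
      nat_power_summand[OF i root_power_unit_interval pq(2)] pq(4) by simp
qed

lemma real_power_summand:
  assumes i: "i \<in> A" and u: "u \<in> {0<..<1}" and t: "t > 0"
  shows "real_power T (a i + (e i - a i) * u) t = a i + (e i - a i) * real_power (S i) u t"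
proof -
  let ?f = "\<lambda>x. a i + (e i - a i) * x"
  let ?R = "{r. 0 < r \<and> of_rat r \<le> t}"
  have len: "e i - a i > 0" and ai: "0 \<le> a i" and ei: "e i \<le> 1"
    using summand_bounds[OF i] by auto
  have mem: "rat_power (S i) u r \<in> {0..1}" if "0 < r" for r
    using tnorm_rat_power_mem[OF summand_tnorm[OF i] that] .
  have f_mem: "?f x \<in> {0..1}" if "x \<in> {0..1}" for x
  proof -
    have "(e i - a i) * x \<le> (e i - a i) * 1" using that len by (intro mult_left_mono) auto
    then have "?f x \<le> 1" using ei by simp
    moreover have "0 \<le> ?f x" using that len ai by simp
    ultimately show ?thesis by simp
  qed
  obtain r where "r \<in> ?R" using exists_pos_rat_le[OF t] by blast
  then have ne: "rat_power (S i) u ` ?R \<noteq> {}" by blast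
  have bdd: "bdd_below (rat_power (S i) u ` ?R)"
    by (rule bdd_belowI[of _ 0]) (use mem in auto)
  have "real_power T (?f u) t = (INF r\<in>?R. ?f (rat_power (S i) u r))"
    using real_power_eq_Inf_pos[OF t, of T "?f u"] rat_power_summand[OF i u] f_mem[OF mem]
    by simp
  also have "\<dots> = ?f (INF r\<in>?R. rat_power (S i) u r)"
    using continuous_at_Inf_mono[of ?f "rat_power (S i) u ` ?R"] len ne bdd
    by (simp add: mono_def image_image continuous_intros)
  also have "\<dots> = ?f (real_power (S i) u t)"
    using real_power_eq_Inf_pos[OF t, of "S i" u] mem by simp
  finally show ?thesis .
qed

end

section \<open>Real powers in ordinal sums\<close>

theorem theorem4:
  fixes A :: "'i set" and a e :: "'i \<Rightarrow> real"
    and S :: "'i \<Rightarrow> real \<Rightarrow> real \<Rightarrow> real" and T :: "real \<Rightarrow> real \<Rightarrow> real"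
  assumes "\<And>i. i \<in> A \<Longrightarrow> continuous_tnorm (S i)"
    and "\<And>i. i \<in> A \<Longrightarrow> archimedean_tnorm (S i)"
    and "is_ordinal_sum T A a e S"
  shows "(\<forall>i\<in>A. \<forall>u\<in>{a i<..<e i}. \<forall>t>0.
            real_power T u t
              = a i + (e i - a i) * real_power (S i) ((u - a i) / (e i - a i)) t \<and>
            (\<forall>G. additive_generator (S i) G \<longrightarrow>
               real_power T u t
                 = a i + (e i - a i) *
                     pseudo_inverse G (ennreal t * G ((u - a i) / (e i - a i))))) \<and>
         (\<forall>u\<in>{0..1} - (\<Union>i\<in>A. {a i<..<e i}). \<forall>t>0. real_power T u t = u)"
proof (intro conjI ballI allI impI)
  fix i u t assume i: "i \<in> A" and u: "u \<in> {a i<..<e i}" and t: "(t::real) > 0"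
  let ?u = "(u - a i) / (e i - a i)"
  have u': "?u \<in> {0<..<1}" and u_eq: "a i + (e i - a i) * ?u = u" using u by auto
  show eq: "real_power T u t = a i + (e i - a i) * real_power (S i) ?u t"
    using real_power_summand[OF assms(3) i u' t] unfolding u_eq .
  fix G assume G: "additive_generator (S i) G"
  have "tnorm (S i)" using assms(1)[OF i] by (simp add: continuous_tnorm_def)
  from real_power_generator[OF this G assms(1)[OF i] u' t]
  show "real_power T u t = a i + (e i - a i) * pseudo_inverse G (ennreal t * G ?u)"
    using eq by simp
next
  fix u t assume "u \<in> {0..1} - (\<Union>i\<in>A. {a i<..<e i})" and "(t::real) > 0"
  then show "real_power T u t = u" by (rule real_power_barrier[OF assms(3)])
qed

end
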